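(* Let $p$ be a prime and $n$ a positive integer. (a) If $n$ and $p$ are odd and $p^2>n$, then $$S_n(p^2)=-p^{n+1}\sum_{\substack{0\le i\le n-2\\ 2i\equiv n-2 \text{ or } 2i\equiv n-4 \pmod p}}\binom{n-2}{i}.$$ (b) If $n$ is even and $p>\max\{2,\sqrt{n/2}\}$, then $$S_n(p^2)=\binom{n-1}{\frac n2-1}\,\frac{p-1}{p}\,p^{n+2}-p^{n+1}\sum_{i\in I}\binom{n-2}{i},$$ where $I$ is the set of integers $i$ with $0\le i\le n-2$, with $i\equiv \frac n2-1$ or $i\equiv\frac n2-2 \pmod p$, and with $i\ne\frac n2-1$ and $i\neq\frac n2-2$.
   Context: For an integer $q\ge 3$, let $\zeta=e^{2\pi i/q}$. For integers $u,v$ the Kloosterman sum is $$K(u,v;q)=\sum_{\substack{0<x\le q\\ (x,q)=1}}\zeta^{ux+v\bar x},$$ where $\bar x$ denotes the multiplicative inverse of $x$ in $(\mathbb{Z}/q\mathbb{Z})^*$. For a positive integer $n$, the $n$-th power moment is $$S_n(q)=\sum_{u=1}^q K(u,1;q)^n.$$ An empty sum is $0$. *)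

theory Defs
  imports Complex_Main "HOL-Number_Theory.Number_Theory"
begin

definition zeta :: "nat \<Rightarrow> complex" where
  "zeta q = exp (2 * of_real pi * \<i> / of_nat q)"

(* modular_inverse q x lies in {0..<q} and inverts x modulo q when x is coprime to q;
   the exponent only matters modulo q. *)
definition kloosterman :: "int \<Rightarrow> int \<Rightarrow> nat \<Rightarrow> complex" where
  "kloosterman u v q =
     (\<Sum>x | 0 < x \<and> x \<le> int q \<and> coprime x (int q).
        zeta q powi (u * x + v * modular_inverse (int q) x))"

definition kloosterman_moment :: "nat \<Rightarrow> nat \<Rightarrow> complex" where
  "kloosterman_moment n q = (\<Sum>u = 1..int q. kloosterman u 1 q ^ n)"

end

theory Submission
  imports Defs "HOL-Library.Real_Mod"
begin

text \<open>
  Modulo $p^2$ with $p$ an odd prime, a Kloosterman sum can be evaluated in closed form, so its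
  moments reduce to sums of roots of unity. Write $e(m) = \zeta^m$ and $q = p^2$.

  Replacing $x$ by $(1 + pt) x$ multiplies the term $e(ux + \bar x)$ of $K(u,1;q)$ by
  $e(pt(ux - \bar x))$, a $p$-th root of unity. Averaging over $t$ modulo $p$ therefore kills every
  term except those with $u x^2 \equiv 1 \pmod p$
  (\<open>kloosterman_prime_square_localised\<close>). By Hensel lifting, such an $x$ exists only if $u$ is the
  square $v^2$ of a unit modulo $p^2$ (\<open>kloosterman_prime_square_nonzero_imp_square\<close>). In that case
  the surviving $x$ are the $p$ lifts of $\bar v$ and the $p$ lifts of $-\bar v$ from residues modulo
  $p$, and the term is constant on each family, whence
  $K(v^2,1;q) = p\,(e(2v) + e(-2v))$ (\<open>kloosterman_prime_square_at_square\<close>).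

  Every such $u$ has exactly two square roots, so $2 S_n(q)$ is the sum of $K(v^2,1;q)^n$ over
  all units $v$. Expanding by the binomial theorem leaves the Ramanujan sums of
  $2(2j - n)$, which are, as $p$ is odd, $p^2$ or $0$ according to whether $p^2 \mid 2j - n$, minus $p$ or $0$
  according to whether $p \mid 2j - n$. This gives \<open>kloosterman_moment_prime_square\<close>:
  \[ 2 S_n(p^2) = p^n \Bigl( p^2 \sum_{p^2 \mid 2j - n} \binom{n}{j}
       - p \sum_{p \mid 2j - n} \binom{n}{j} \Bigr). \]

  The size condition on $p$ leaves in the first sum at most the central term $2j = n$, which
  exists exactly for even $n$. In the second sum, applying Pascal's rule twice and the symmetry
  $i \mapsto n - 2 - i$ turns the single residue class for $\binom{n}{j}$ into twice the two classes for
  $\binom{n-2}{i}$ (\<open>sum_binomial_centered_class\<close>). For even $n$ those two classes contain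
  $i = n/2 - 1$ and, if $n > 2$, $i = n/2 - 2$, whose coefficients add up to $\binom{n-1}{n/2-1}$, that is, to
  half of $\binom{n}{n/2}$; separating them from the rest yields the factor $p^{n+2} - p^{n+1}$.
\<close>

section \<open>Additive characters\<close>

lemma zeta_nonzero [simp]: "zeta q \<noteq> 0"
  by (simp add: zeta_def)

lemma zeta_powi_eq_1_iff:
  assumes "q > 0"
  shows "zeta q powi m = 1 \<longleftrightarrow> int q dvd m"
proof -
  have "zeta q = cis (2 * pi / q)"
    by (simp add: zeta_def cis_conv_exp mult_ac)
  hence "zeta q powi m = 1 \<longleftrightarrow> (\<exists>k. of_int m * (2 * pi / q) = of_int k * (2 * pi))"
    by (simp add: cis_power_int cis_eq_1_iff)
  also have "\<dots> \<longleftrightarrow> (\<exists>k. m = int q * k)"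
  proof (intro ex_cong1)
    fix k :: int
    have "of_int m * (2 * pi / q) = of_int k * (2 * pi) \<longleftrightarrow> of_int m = (of_nat q * of_int k :: real)"
      using assms by (simp add: field_simps)
    also have "\<dots> \<longleftrightarrow> m = int q * k"
      by (metis of_int_eq_iff of_int_mult of_int_of_nat_eq)
    finally show "of_int m * (2 * pi / q) = of_int k * (2 * pi) \<longleftrightarrow> m = int q * k" .
  qed
  finally show ?thesis by (simp add: dvd_def)
qed

lemma zeta_powi_cong:
  assumes "q > 0" "[a = b] (mod int q)"
  shows "zeta q powi a = zeta q powi b"
proof -
  obtain k where k: "a = b + int q * k"
    using assms(2) by (metis cong_iff_lin cong_sym)
  have "zeta q powi (int q * k) = 1"
    using assms(1) by (simp add: zeta_powi_eq_1_iff)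
  thus ?thesis by (simp add: k power_int_add)
qed

lemma zeta_mult_powi:
  assumes "b > 0"
  shows "zeta (a * b) powi (int b * m) = zeta a powi m"
proof -
  have "zeta (a * b) powi int b = zeta a"
    using assms by (simp add: zeta_def power_int_of_nat flip: exp_of_nat_mult)
  thus ?thesis by (simp add: power_int_mult)
qed

lemma sum_zeta_powi:
  assumes "q > 0"
  shows "(\<Sum>t<q. zeta q powi (m * int t)) = (if int q dvd m then of_nat q else 0)"
proof -
  have eq: "zeta q powi (m * int t) = (zeta q powi m) ^ t" for t
    by (simp add: power_int_mult)
  show ?thesis
  proof (cases "int q dvd m")
    case True
    hence "zeta q powi m = 1" using assms by (simp add: zeta_powi_eq_1_iff)
    thus ?thesis using True by (simp add: eq)
  next
    case False
    have "(zeta q powi m) ^ q = zeta q powi (m * int q)"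
      by (simp add: power_int_mult)
    also have "\<dots> = 1"
      using assms by (simp add: zeta_powi_eq_1_iff)
    finally have "(zeta q powi m) ^ q = 1" .
    thus ?thesis using False assms 
      by (simp add: eq zeta_powi_eq_1_iff geometric_sum)
  qed
qed

section \<open>Units modulo $q$\<close>

definition units_mod :: "nat \<Rightarrow> int set" where
  "units_mod q = {x. 0 < x \<and> x \<le> int q \<and> coprime x (int q)}"

lemma finite_units_mod [simp]: "finite (units_mod q)"
  by (rule finite_subset[of _ "{0..int q}"]) (auto simp: units_mod_def)

lemma mod_in_units_mod:
  assumes "q > 1" "coprime x (int q)"
  shows "x mod int q \<in> units_mod q"
proof -
  have "coprime (x mod int q) (int q)"
    using assms by auto
  moreover from this have "x mod int q \<noteq> 0"
    using assms by auto
  moreover have "x mod int q \<ge> 0" "x mod int q < int q"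
    using assms by auto
  ultimately show ?thesis
    unfolding units_mod_def by auto
qed

lemma units_mod_less: "x \<in> units_mod q \<Longrightarrow> q > 1 \<Longrightarrow> x < int q"
  by (cases "x = int q") (auto simp: units_mod_def)

lemma units_mod_cong_imp_eq:
  assumes "q > 1" "x \<in> units_mod q" "y \<in> units_mod q" "[x = y] (mod int q)"
  shows "x = y"
  using assms units_mod_less[of x q] units_mod_less[of y q]
  by (auto simp: units_mod_def cong_def)

text \<open>
  A sum of a $q$-periodic function over the units does not depend on the choice of representatives, so
  multiplication by a unit is a change of variables in it.
\<close>

lemma sum_units_mod_mult:
  fixes f :: "int \<Rightarrow> complex"
  assumes q: "q > 1" and c: "coprime c (int q)"
    and per: "\<And>x y. [x = y] (mod int q) \<Longrightarrow> f x = f y"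
  shows "(\<Sum>x\<in>units_mod q. f (c * x)) = (\<Sum>x\<in>units_mod q. f x)"
proof -
  let ?g = "\<lambda>x. c * x mod int q"
  have maps: "?g ` units_mod q \<subseteq> units_mod q"
  proof clarify
    fix x assume "x \<in> units_mod q"
    hence "coprime (c * x) (int q)" using c by (simp add: units_mod_def)
    thus "?g x \<in> units_mod q" by (rule mod_in_units_mod[OF q])
  qed
  have inj: "inj_on ?g (units_mod q)"
  proof (rule inj_onI)
    fix x y assume *: "x \<in> units_mod q" "y \<in> units_mod q" "?g x = ?g y"
    have "[x = y] (mod int q)"
      using *(3) c by (metis cong_def cong_mult_lcancel)
    thus "x = y" using units_mod_cong_imp_eq q * by blast
  qed
  have "bij_betw ?g (units_mod q) (units_mod q)"
    using maps inj by (simp add: bij_betw_def endo_inj_surj)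
  hence "(\<Sum>x\<in>units_mod q. f (?g x)) = (\<Sum>x\<in>units_mod q. f x)"
    by (rule sum.reindex_bij_betw)
  moreover have "f (?g x) = f (c * x)" for x
    by (rule per) simp
  ultimately show ?thesis by simp
qed

lemma modular_inverse_unique_mod:
  fixes x :: int
  assumes "[x * y = 1] (mod m)"
  shows "[modular_inverse m x = y] (mod m)"
proof -
  have cop: "coprime x m"
    using assms coprime_iff_invertible_int by blast
  have "[x * modular_inverse m x = x * y] (mod m)"
    using cong_modular_inverse1[OF cop] assms by (metis cong_sym cong_trans)
  thus ?thesis using cop by (simp add: cong_mult_lcancel)
qed

lemma modular_inverse_cong:
  fixes x y :: int
  assumes "[x = y] (mod m)"
  shows "[modular_inverse m x = modular_inverse m y] (mod m)"
proof (cases "coprime y m")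
  case True
  have "[x * modular_inverse m y = y * modular_inverse m y] (mod m)"
    using assms by (rule cong_scalar_right)
  also have "[y * modular_inverse m y = 1] (mod m)"
    using True by (rule cong_modular_inverse1)
  finally show ?thesis by (rule modular_inverse_unique_mod)
next
  case False
  hence "\<not> coprime x m"
    using assms cong_imp_coprime by blast
  with False show ?thesis
    by (simp add: modular_inverse_def coprime_commute)
qed

lemma coprime_one_plus_mult: "coprime (1 + int p * k) (int p)"
proof -
  have "[1 = 1 + int p * k] (mod int p)" by (simp add: cong_def)
  thus ?thesis by (rule cong_imp_coprime) simp
qed

lemma odd_prime_not_dvd_2:
  fixes p :: nat
  assumes "prime p" "odd p"
  shows "\<not> int p dvd 2"
  using assms
  by (metis int_dvd_int_iff of_nat_numeral primes_dvd_imp_eq two_is_prime_nat even_numeral)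

section \<open>Kloosterman sums modulo the square of a prime\<close>

lemma kloosterman_units_mod:
  "kloosterman u v q = (\<Sum>x\<in>units_mod q. zeta q powi (u * x + v * modular_inverse (int q) x))"
  by (simp add: kloosterman_def units_mod_def)

lemma kloosterman_cong:
  assumes "q > 0" "[u = u'] (mod int q)"
  shows "kloosterman u v q = kloosterman u' v q"
  unfolding kloosterman_def
  by (intro sum.cong refl zeta_powi_cong cong_add cong_mult assms) auto

text \<open>
  The average over the substitutions $x \mapsto (1 + pt) x$ with $0 \le t < p$: since
  $(1 + pt)(1 - pt) \equiv 1 \pmod{p^2}$, each of them twists the term of $x$ by a power of a $p$-th root of
  unity with exponent proportional to $u x - \bar x$, and orthogonality keeps only the $x$ with
  $u x \equiv \bar x \pmod p$. This is the discrete analogue of stationary phase, with the congruence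
  as the equation of the critical points.
\<close>

lemma kloosterman_prime_square_localised:
  fixes p :: nat
  assumes p: "prime p"
  shows "kloosterman u 1 (p\<^sup>2) =
    (\<Sum>x\<in>{x\<in>units_mod (p\<^sup>2). int p dvd u * x\<^sup>2 - 1}.
        zeta (p\<^sup>2) powi (u * x + modular_inverse (int (p\<^sup>2)) x))"
proof -
  define q where "q = p\<^sup>2"
  define iv where "iv = modular_inverse (int q)"
  define F where "F = (\<lambda>x. zeta q powi (u * x + iv x))"
  have p1: "p > 1" using p prime_gt_1_nat by blast
  hence q1: "q > 1" unfolding q_def by (rule one_less_power) simp
  have inv1: "[x * iv x = 1] (mod int q)" if "coprime x (int q)" for x
    unfolding iv_def by (rule cong_modular_inverse1[OF that])
  have shift: "kloosterman u 1 q = (\<Sum>x\<in>units_mod q. F x * zeta p powi ((u * x - iv x) * int t))" for t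
  proof -
    define c where "c = 1 + int p * int t"
    have cop: "coprime c (int q)"
      using coprime_one_plus_mult by (simp add: c_def q_def)
    have c': "[c * (1 - int p * int t) = 1] (mod int q)"
    proof -
      have "c * (1 - int p * int t) - 1 = int q * - (int t)\<^sup>2"
        by (simp add: c_def q_def algebra_simps power2_eq_square)
      thus ?thesis by (metis cong_iff_dvd_diff dvd_triv_left)
    qed
    have per: "F x = F y" if "[x = y] (mod int q)" for x y
      unfolding F_def iv_def using q1 that
      by (intro zeta_powi_cong cong_add cong_mult modular_inverse_cong) auto
    have "kloosterman u 1 q = (\<Sum>x\<in>units_mod q. F x)"
      by (simp add: kloosterman_units_mod F_def iv_def)
    also have "\<dots> = (\<Sum>x\<in>units_mod q. F (c * x))"
      by (rule sum_units_mod_mult[OF q1 cop, symmetric]) (rule per)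
    also have "\<dots> = (\<Sum>x\<in>units_mod q. F x * zeta p powi ((u * x - iv x) * int t))"
    proof (intro sum.cong refl)
      fix x assume x: "x \<in> units_mod q"
      hence xc: "coprime x (int q)" by (simp add: units_mod_def)
      have "[c * x * ((1 - int p * int t) * iv x) = 1] (mod int q)"
        using cong_mult[OF c' inv1[OF xc]] by (simp add: mult_ac)
      hence "[iv (c * x) = (1 - int p * int t) * iv x] (mod int q)"
        unfolding iv_def by (rule modular_inverse_unique_mod)
      hence "[u * (c * x) + iv (c * x) = u * (c * x) + (1 - int p * int t) * iv x] (mod int q)"
        by (intro cong_add) auto
      also have "u * (c * x) + (1 - int p * int t) * iv x = (u * x + iv x) + int p * ((u * x - iv x) * int t)"
        by (simp add: c_def algebra_simps)
      finally have "zeta q powi (u * (c * x) + iv (c * x)) = 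
          zeta q powi ((u * x + iv x) + int p * ((u * x - iv x) * int t))"
        using q1 by (intro zeta_powi_cong) auto
      also have "\<dots> = F x * zeta p powi ((u * x - iv x) * int t)"
        using zeta_mult_powi[of p p] p1
        by (simp add: power_int_add F_def q_def power2_eq_square)
      finally show "F (c * x) = F x * zeta p powi ((u * x - iv x) * int t)"
        by (simp only: F_def)
    qed
    finally show ?thesis .
  qed
  have "of_nat p * kloosterman u 1 q = (\<Sum>t<p. kloosterman u 1 q)"
    by simp
  also have "\<dots> = (\<Sum>t<p. \<Sum>x\<in>units_mod q. F x * zeta p powi ((u * x - iv x) * int t))"
    by (intro sum.cong refl shift)
  also have "\<dots> = (\<Sum>x\<in>units_mod q. F x * (\<Sum>t<p. zeta p powi ((u * x - iv x) * int t)))"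
    by (subst sum.swap) (simp add: sum_distrib_left)
  also have "\<dots> = (\<Sum>x\<in>units_mod q. if int p dvd u * x\<^sup>2 - 1 then of_nat p * F x else 0)"
  proof (intro sum.cong refl)
    fix x assume x: "x \<in> units_mod q"
    hence xc: "coprime x (int q)" by (simp add: units_mod_def)
    have "int p dvd int q" by (simp add: q_def)
    hence i: "[x * iv x = 1] (mod int p)"
      using inv1[OF xc] cong_dvd_modulus by blast
    have xp: "coprime x (int p)" using xc by (simp add: q_def)
    have "int p dvd u * x - iv x \<longleftrightarrow> int p dvd x * (u * x - iv x)"
      using xp by (simp add: coprime_commute coprime_dvd_mult_right_iff)
    also have "\<dots> \<longleftrightarrow> int p dvd u * x\<^sup>2 - x * iv x"
      by (simp add: algebra_simps power2_eq_square)
    also have "\<dots> \<longleftrightarrow> int p dvd u * x\<^sup>2 - 1"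
      using i cong_dvd_iff[OF cong_diff[OF cong_refl i]] by blast
    finally show "F x * (\<Sum>t<p. zeta p powi ((u * x - iv x) * int t)) = 
      (if int p dvd u * x\<^sup>2 - 1 then of_nat p * F x else 0)"
      using p1 by (simp add: sum_zeta_powi)
  qed
  also have "\<dots> = of_nat p * (\<Sum>x\<in>{x\<in>units_mod q. int p dvd u * x\<^sup>2 - 1}. F x)"
    by (subst sum.inter_filter[symmetric]) (auto simp: sum_distrib_left)
  finally show ?thesis
    using p1 by (simp add: q_def F_def iv_def)
qed

lemma card_units_mod_prime_square_residue:
  fixes p :: nat
  assumes p: "prime p" and a: "coprime a (int p)"
  shows "card {x\<in>units_mod (p\<^sup>2). int p dvd a * x - 1} = p"
proof -
  define b where "b = modular_inverse (int p) a"
  have p1: "p > 1" using p prime_gt_1_nat by blast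
  have b: "[a * b = 1] (mod int p)"
    unfolding b_def by (rule cong_modular_inverse1[OF a])
  have "b \<ge> 0" "b < int p"
    using p1 by (simp_all add: b_def modular_inverse_int_nonneg modular_inverse_int_less)
  moreover have "b \<noteq> 0"
    using b p1 by (auto simp: cong_def)
  ultimately have b_range: "0 < b" "b < int p" by auto
  let ?g = "\<lambda>k. b + int p * int k"
  have "{x\<in>units_mod (p\<^sup>2). int p dvd a * x - 1} = ?g ` {..<p}"
  proof (intro equalityI subsetI)
    fix x assume "x \<in> {x\<in>units_mod (p\<^sup>2). int p dvd a * x - 1}"
    hence x: "x \<in> units_mod (p\<^sup>2)" "[a * x = 1] (mod int p)"
      by (auto simp: cong_iff_dvd_diff)
    have "x < int (p\<^sup>2)"
      by (rule units_mod_less[OF x(1)]) (use p1 in \<open>simp add: one_less_power del: One_nat_def\<close>)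
    hence x_range: "0 < x" "x < int p * int p"
      using x(1) by (auto simp: units_mod_def power2_eq_square)
    have "[a * x = a * b] (mod int p)"
      using x(2) b cong_sym cong_trans by blast
    hence "[x = b] (mod int p)"
      using a by (simp add: cong_mult_lcancel)
    hence "x mod int p = b"
      using b_range by (simp add: cong_def)
    hence "x = b + int p * int (nat (x div int p))"
      using x_range p1 by (metis div_mult_mod_eq add.commute mult.commute nat_0_le of_nat_0_le_iff
          pos_imp_zdiv_nonneg_iff order_less_imp_le of_nat_0_less_iff less_trans zero_less_one)
    moreover have "nat (x div int p) < p"
    proof -
      have "int p * (x div int p) + x mod int p = x" "x mod int p \<ge> 0"
        using p1 by simp_all
      hence "int p * (x div int p) < int p * int p"
        using x_range(2) by linarith
      thus ?thesis
        using p1 x_range(1) by (simp add: nat_less_iff pos_imp_zdiv_nonneg_iff)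
    qed
    ultimately show "x \<in> ?g ` {..<p}" by blast
  next
    fix x assume "x \<in> ?g ` {..<p}"
    then obtain k where k: "k < p" "x = ?g k" by auto
    have "int p * int k + int p \<le> int p * int p"
      using k(1) mult_left_mono[of "int k + 1" "int p" "int p"] by (simp add: algebra_simps)
    moreover have "int p * int k \<ge> 0" by simp
    ultimately have "0 < x" "x \<le> int (p\<^sup>2)"
      using k(2) b_range unfolding power2_eq_square of_nat_mult by linarith+
    moreover have "[a * x = 1] (mod int p)"
      using b cong_mult_self_left[of "int p" "a * int k"] unfolding k(2)
      by (metis cong_add_rcancel_0 cong_trans cong_mult_self_left distrib_left mult.left_commute cong_def mod_mult_self2)
    moreover from this have "coprime x (int p)"
      by (metis coprime_iff_invertible_int mult.commute)
    ultimately show "x \<in> {x\<in>units_mod (p\<^sup>2). int p dvd a * x - 1}"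
      by (simp add: units_mod_def cong_iff_dvd_diff)
  qed
  moreover have "inj_on ?g {..<p}"
    using p1 by (auto simp: inj_on_def)
  ultimately show ?thesis by (simp add: card_image)
qed

text \<open>
  The lifts to modulus $p^2$ of one critical point for $u = a^2$. The phase has the same value at all
  of them, because
  $x (a^2 x + \bar x - 2a) \equiv (ax - 1)^2 \pmod{p^2}$ and the square of a multiple of $p$ vanishes.
\<close>

lemma sum_near_critical_point:
  fixes p :: nat
  assumes p: "prime p" and a: "coprime a (int p)"
  shows "(\<Sum>x\<in>{x\<in>units_mod (p\<^sup>2). int p dvd a * x - 1}.
            zeta (p\<^sup>2) powi (a\<^sup>2 * x + modular_inverse (int (p\<^sup>2)) x))
         = of_nat p * zeta (p\<^sup>2) powi (2 * a)"
proof -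
  have p0: "p > 0" using p prime_gt_0_nat by blast
  have "zeta (p\<^sup>2) powi (a\<^sup>2 * x + modular_inverse (int (p\<^sup>2)) x) = zeta (p\<^sup>2) powi (2 * a)"
    if x: "x \<in> units_mod (p\<^sup>2)" "int p dvd a * x - 1" for x
  proof (rule zeta_powi_cong)
    let ?y = "modular_inverse (int (p\<^sup>2)) x"
    have xc: "coprime x (int (p\<^sup>2))" using x(1) by (simp add: units_mod_def)
    have "int (p\<^sup>2) dvd (a * x - 1)\<^sup>2"
      using x(2) by (simp add: dvd_power_same)
    moreover have "int (p\<^sup>2) dvd x * ?y - 1"
      using cong_modular_inverse1[OF xc] by (simp add: cong_iff_dvd_diff)
    ultimately have "int (p\<^sup>2) dvd (a * x - 1)\<^sup>2 + (x * ?y - 1)"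
      by (rule dvd_add)
    also have "(a * x - 1)\<^sup>2 + (x * ?y - 1) = x * (a\<^sup>2 * x + ?y - 2 * a)"
      by (simp add: algebra_simps power2_eq_square)
    finally have "int (p\<^sup>2) dvd a\<^sup>2 * x + ?y - 2 * a"
      using xc by (simp add: coprime_commute coprime_dvd_mult_right_iff)
    thus "[a\<^sup>2 * x + ?y = 2 * a] (mod int (p\<^sup>2))"
      by (simp add: cong_iff_dvd_diff)
  qed (use p0 in simp)
  hence "(\<Sum>x\<in>{x\<in>units_mod (p\<^sup>2). int p dvd a * x - 1}.
            zeta (p\<^sup>2) powi (a\<^sup>2 * x + modular_inverse (int (p\<^sup>2)) x))
      = (\<Sum>x\<in>{x\<in>units_mod (p\<^sup>2). int p dvd a * x - 1}. zeta (p\<^sup>2) powi (2 * a))"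
    by (intro sum.cong refl) blast
  thus ?thesis
    by (simp only: sum_constant card_units_mod_prime_square_residue[OF p a])
qed

lemma kloosterman_prime_square_at_square:
  fixes p :: nat
  assumes p: "prime p" "odd p" and v: "coprime v (int p)"
  shows "kloosterman (v\<^sup>2) 1 (p\<^sup>2) =
    of_nat p * (zeta (p\<^sup>2) powi (2 * v) + zeta (p\<^sup>2) powi (- 2 * v))"
proof -
  let ?A = "\<lambda>a. {x\<in>units_mod (p\<^sup>2). int p dvd a * x - 1}"
  let ?F = "\<lambda>x. zeta (p\<^sup>2) powi (v\<^sup>2 * x + modular_inverse (int (p\<^sup>2)) x)"
  have pp: "prime (int p)" using p by simp
  have "int p dvd v\<^sup>2 * x\<^sup>2 - 1 \<longleftrightarrow> int p dvd v * x - 1 \<or> int p dvd (- v) * x - 1" for x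
  proof -
    have "v\<^sup>2 * x\<^sup>2 - 1 = - ((v * x - 1) * (- v * x - 1))"
      by (simp add: algebra_simps power2_eq_square)
    thus ?thesis by (simp only: dvd_minus_iff prime_dvd_mult_iff[OF pp])
  qed
  hence "{x\<in>units_mod (p\<^sup>2). int p dvd v\<^sup>2 * x\<^sup>2 - 1} = ?A v \<union> ?A (- v)"
    by blast
  moreover have "?A v \<inter> ?A (- v) = {}"
  proof -
    have False if "int p dvd v * x - 1" "int p dvd (- v) * x - 1" for x
      using dvd_add[OF that] odd_prime_not_dvd_2[OF p] by simp
    thus ?thesis by blast
  qed
  ultimately have "kloosterman (v\<^sup>2) 1 (p\<^sup>2) = sum ?F (?A v) + sum ?F (?A (- v))"
    by (simp add: kloosterman_prime_square_localised[OF p(1)] sum.union_disjoint)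
  also have "sum ?F (?A v) = of_nat p * zeta (p\<^sup>2) powi (2 * v)"
    by (rule sum_near_critical_point[OF p(1) v])
  also have "sum ?F (?A (- v)) = of_nat p * zeta (p\<^sup>2) powi (2 * - v)"
    using sum_near_critical_point[OF p(1), of "- v"] v by simp
  finally show ?thesis by (simp add: algebra_simps)
qed

text \<open>
  A nonzero sum has a surviving term, so $u$ is a square modulo $p$; one Hensel step makes it a
  square modulo $p^2$.
\<close>

lemma kloosterman_prime_square_nonzero_imp_square:
  fixes p :: nat
  assumes p: "prime p" "odd p" and nz: "kloosterman u 1 (p\<^sup>2) \<noteq> 0"
  shows "\<exists>v\<in>units_mod (p\<^sup>2). [v\<^sup>2 = u] (mod int (p\<^sup>2))"
proof -
  let ?q = "int (p\<^sup>2)"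
  have p1: "p > 1" using p prime_gt_1_nat by blast
  hence q1: "p\<^sup>2 > 1" by (rule one_less_power) simp
  obtain x where x: "x \<in> units_mod (p\<^sup>2)" "int p dvd u * x\<^sup>2 - 1"
    using nz unfolding kloosterman_prime_square_localised[OF p(1)] by (blast elim: sum.not_neutral_contains_not_neutral)
  obtain k where k: "u * x\<^sup>2 = 1 + int p * k"
    using x(2) by (metis dvdE diff_eq_eq add.commute)
  define y where "y = modular_inverse ?q x"
  have xc: "coprime x ?q" using x(1) by (simp add: units_mod_def)
  have xy: "[x * y = 1] (mod ?q)"
    unfolding y_def by (rule cong_modular_inverse1[OF xc])
  have yc: "coprime y ?q"
    unfolding y_def by (rule coprime_modular_inverse[OF xc])
  obtain h where h: "int p + 1 = 2 * h"
    using p(2) by (metis dvdE even_add even_of_nat_iff odd_one)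
  \<comment> \<open>From $u \equiv y^2 (1 + pk)$, and as $h$ inverts $2$ modulo $p$, the factor $1 + pkh$ is a square root
    of $1 + pk$ modulo $p^2$.\<close>
  define v where "v = y * (1 + int p * (k * h))"
  have "(1 + int p * (k * h))\<^sup>2 = 1 + int p * k * (2 * h) + ?q * (k * h)\<^sup>2"
    by (simp add: algebra_simps power2_eq_square)
  also have "\<dots> = (1 + int p * k) + ?q * (k + (k * h)\<^sup>2)"
    unfolding h[symmetric] by (simp add: algebra_simps power2_eq_square)
  also have "[\<dots> = 1 + int p * k] (mod ?q)"
    by (simp add: cong_def)
  finally have sq: "[(1 + int p * (k * h))\<^sup>2 = 1 + int p * k] (mod ?q)" .
  have "v\<^sup>2 = y\<^sup>2 * (1 + int p * (k * h))\<^sup>2"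
    by (simp add: v_def power_mult_distrib)
  also have "[\<dots> = y\<^sup>2 * (u * x\<^sup>2)] (mod ?q)"
    unfolding k by (intro cong_mult cong_refl sq)
  also have "y\<^sup>2 * (u * x\<^sup>2) = u * (x * y)\<^sup>2"
    by (simp add: algebra_simps power2_eq_square)
  also have "[\<dots> = u * 1\<^sup>2] (mod ?q)"
    by (intro cong_mult cong_refl cong_pow xy)
  finally have vu: "[v\<^sup>2 = u] (mod ?q)" by simp
  have "coprime v ?q"
    using yc coprime_one_plus_mult[of p "k * h"] by (simp add: v_def)
  hence "v mod ?q \<in> units_mod (p\<^sup>2)"
    by (rule mod_in_units_mod[OF q1])
  moreover have "[(v mod ?q)\<^sup>2 = u] (mod ?q)"
    using vu cong_pow[of "v mod ?q" v ?q 2] cong_trans by fastforce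
  ultimately show ?thesis by blast
qed

text \<open>
  The two square roots are $w$ and $-w$: an odd prime cannot divide both $v - w$ and $v + w$ for
  units $v$ and $w$, so $p^2$ must divide one factor of $v^2 - w^2$ entirely.
\<close>

lemma card_square_roots_prime_square:
  fixes p :: nat
  assumes p: "prime p" "odd p" and w: "w \<in> units_mod (p\<^sup>2)" "[w\<^sup>2 = u] (mod int (p\<^sup>2))"
  shows "card {v\<in>units_mod (p\<^sup>2). [v\<^sup>2 = u] (mod int (p\<^sup>2))} = 2"
proof -
  let ?q = "int (p\<^sup>2)"
  have p1: "p > 1" using p prime_gt_1_nat by blast
  hence q1: "p\<^sup>2 > 1" by (rule one_less_power) simp
  have pp: "prime (int p)" using p by simp
  have wr: "0 < w" "w < ?q" "coprime w ?q"
    using w(1) units_mod_less[OF w(1) q1] by (auto simp: units_mod_def)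
  have w': "?q - w \<in> units_mod (p\<^sup>2)"
  proof -
    have "(?q - w) = - w + ?q * 1" by simp
    hence "coprime (?q - w) ?q"
      using wr(3) by (metis coprime_minus_left_iff cong_imp_coprime cong_def mod_mult_self2)
    thus ?thesis using wr by (simp add: units_mod_def)
  qed
  have not_w: "\<not> int p dvd 2 * w"
  proof
    assume "int p dvd 2 * w"
    hence "int p dvd w"
      using odd_prime_not_dvd_2[OF p] by (simp add: prime_dvd_mult_iff[OF pp])
    moreover have "coprime w (int p)" using wr(3) by simp
    ultimately show False using pp
      by (metis coprime_common_divisor dvd_refl not_prime_unit)
  qed
  have "{v\<in>units_mod (p\<^sup>2). [v\<^sup>2 = u] (mod ?q)} = {w, ?q - w}"
  proof (intro equalityI subsetI)
    fix v assume "v \<in> {v\<in>units_mod (p\<^sup>2). [v\<^sup>2 = u] (mod ?q)}"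
    hence v: "v \<in> units_mod (p\<^sup>2)" "[v\<^sup>2 = w\<^sup>2] (mod ?q)"
      using w(2) by (auto intro: cong_trans cong_sym)
    have prod: "?q dvd (v - w) * (v + w)"
      using v(2) by (simp add: cong_iff_dvd_diff algebra_simps power2_eq_square)
    have "\<not> (int p dvd v - w \<and> int p dvd v + w)"
      using not_w dvd_diff[of "int p" "v + w" "v - w"] by auto
    then consider "\<not> int p dvd v - w" | "\<not> int p dvd v + w" by blast
    thus "v \<in> {w, ?q - w}"
    proof cases
      case 1
      hence "coprime ?q (v - w)"
        using pp by (simp add: prime_imp_coprime)
      hence "?q dvd v + w"
        using prod by (simp add: coprime_dvd_mult_right_iff)
      hence "?q dvd v - (?q - w)" 
        using dvd_diff[of ?q "v + w" ?q] by (simp add: algebra_simps)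
      thus ?thesis
        using units_mod_cong_imp_eq[OF q1 v(1) w'] by (simp add: cong_iff_dvd_diff)
    next
      case 2
      hence "coprime ?q (v + w)"
        using pp by (simp add: prime_imp_coprime)
      hence "?q dvd v - w"
        using prod by (simp add: coprime_dvd_mult_left_iff)
      thus ?thesis
        using units_mod_cong_imp_eq[OF q1 v(1) w(1)] by (simp add: cong_iff_dvd_diff)
    qed
  next
    fix v assume "v \<in> {w, ?q - w}"
    moreover have "[(?q - w)\<^sup>2 = w\<^sup>2] (mod ?q)"
    proof -
      have "(?q - w)\<^sup>2 - w\<^sup>2 = ?q * (?q - 2 * w)"
        by (simp add: algebra_simps power2_eq_square)
      thus ?thesis by (metis cong_iff_dvd_diff dvd_triv_left)
    qed
    ultimately show "v \<in> {v\<in>units_mod (p\<^sup>2). [v\<^sup>2 = u] (mod ?q)}"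
      using w w' cong_trans by blast
  qed
  moreover have "w \<noteq> ?q - w"
  proof
    assume "w = ?q - w"
    hence "2 * w = ?q" by simp
    thus False using not_w by simp
  qed
  ultimately show ?thesis by simp
qed

text \<open>
  Summing over square roots $v$ instead of over $u$ counts every $u$ with a nonzero term twice. The
  remaining $u$ contribute $0$ because $n$ is positive.
\<close>

lemma kloosterman_moment_prime_square_square_roots:
  fixes p n :: nat
  assumes p: "prime p" "odd p" and n: "n > 0"
  shows "2 * kloosterman_moment n (p\<^sup>2) =
           (\<Sum>v\<in>units_mod (p\<^sup>2). kloosterman (v\<^sup>2) 1 (p\<^sup>2) ^ n)"
proof -
  let ?q = "int (p\<^sup>2)"
  have p1: "p > 1" using p prime_gt_1_nat by blast
  hence q1: "p\<^sup>2 > 1" by (rule one_less_power) simp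
  hence q0: "p\<^sup>2 > 0" by linarith
  have maps: "(\<lambda>v. v\<^sup>2 mod ?q) ` units_mod (p\<^sup>2) \<subseteq> {1..?q}"
  proof clarify
    fix v assume "v \<in> units_mod (p\<^sup>2)"
    hence "v\<^sup>2 mod ?q \<in> units_mod (p\<^sup>2)"
      by (intro mod_in_units_mod[OF q1]) (simp add: units_mod_def)
    thus "v\<^sup>2 mod ?q \<in> {1..?q}" by (simp add: units_mod_def)
  qed
  have fibre: "(\<Sum>v\<in>{v\<in>units_mod (p\<^sup>2). v\<^sup>2 mod ?q = u}. kloosterman (v\<^sup>2) 1 (p\<^sup>2) ^ n)
      = 2 * kloosterman u 1 (p\<^sup>2) ^ n" if u: "u \<in> {1..?q}" for u
  proof (cases "kloosterman u 1 (p\<^sup>2) = 0")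
    case True
    have "kloosterman (v\<^sup>2) 1 (p\<^sup>2) = 0" if "v\<^sup>2 mod ?q = u" for v
      using True kloosterman_cong[OF q0, of "v\<^sup>2" u] that by (auto simp: cong_def)
    thus ?thesis using True n by simp
  next
    case False
    obtain w where w: "w \<in> units_mod (p\<^sup>2)" "[w\<^sup>2 = u] (mod ?q)"
      using kloosterman_prime_square_nonzero_imp_square[OF p False] by blast
    have "coprime u ?q"
      using w by (metis (mono_tags, lifting) cong_imp_coprime coprime_power_left_iff mem_Collect_eq units_mod_def)
    hence "u \<in> units_mod (p\<^sup>2)" using u by (simp add: units_mod_def)
    hence "u mod ?q = u" using units_mod_less[OF _ q1] u by simp
    hence "{v\<in>units_mod (p\<^sup>2). v\<^sup>2 mod ?q = u} = {v\<in>units_mod (p\<^sup>2). [v\<^sup>2 = u] (mod ?q)}"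
      by (simp add: cong_def)
    moreover have "kloosterman (v\<^sup>2) 1 (p\<^sup>2) = kloosterman u 1 (p\<^sup>2)" if "[v\<^sup>2 = u] (mod ?q)" for v
      by (rule kloosterman_cong[OF q0 that])
    ultimately show ?thesis
      using card_square_roots_prime_square[OF p w] by simp
  qed
  have "(\<Sum>v\<in>units_mod (p\<^sup>2). kloosterman (v\<^sup>2) 1 (p\<^sup>2) ^ n) =
     (\<Sum>u\<in>{1..?q}. \<Sum>v\<in>{v\<in>units_mod (p\<^sup>2). v\<^sup>2 mod ?q = u}. kloosterman (v\<^sup>2) 1 (p\<^sup>2) ^ n)"
    by (rule sum.group[OF _ _ maps, symmetric]) auto
  also have "\<dots> = (\<Sum>u\<in>{1..?q}. 2 * kloosterman u 1 (p\<^sup>2) ^ n)"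
    by (intro sum.cong refl fibre)
  also have "\<dots> = 2 * kloosterman_moment n (p\<^sup>2)"
    by (simp add: kloosterman_moment_def sum_distrib_left)
  finally show ?thesis ..
qed

section \<open>Ramanujan sums\<close>

text \<open>
  The Ramanujan sum $c_{p^2}(m)$: the complete sum over all residues modulo $p^2$, minus the sum over the
  multiples of $p$, which is a complete sum modulo $p$.
\<close>

lemma sum_units_mod_prime_square_zeta:
  fixes p :: nat
  assumes p: "prime p"
  shows "(\<Sum>v\<in>units_mod (p\<^sup>2). zeta (p\<^sup>2) powi (m * v)) =
    of_nat p ^ 2 * of_bool (int (p\<^sup>2) dvd m) - of_nat p * of_bool (int p dvd m)"
proof -
  let ?f = "\<lambda>x. zeta (p\<^sup>2) powi (m * x)"
  let ?M = "(\<lambda>t. int p * int t) ` {..<p}"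
  have p1: "p > 1" using p prime_gt_1_nat by blast
  hence q1: "p\<^sup>2 > 1" by (rule one_less_power) simp
  have pp: "prime (int p)" using p by simp
  have split: "int ` {..<p\<^sup>2} = units_mod (p\<^sup>2) \<union> ?M"
  proof (intro equalityI subsetI)
    fix x assume "x \<in> int ` {..<p\<^sup>2}"
    then obtain a where a: "x = int a" "a < p\<^sup>2" by auto
    show "x \<in> units_mod (p\<^sup>2) \<union> ?M"
    proof (cases "p dvd a")
      case True
      then obtain t where t: "a = p * t" by auto
      hence "t < p" using a(2) p1 by (simp add: power2_eq_square)
      thus ?thesis using a t by auto
    next
      case False
      hence "coprime p a" using p prime_imp_coprime by blast
      hence "coprime x (int p)" using a by (simp add: coprime_commute)
      moreover have "a \<noteq> 0" using False by (intro notI) simp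
      ultimately show ?thesis using a by (simp add: units_mod_def del: of_nat_power)
    qed
  next
    fix x assume "x \<in> units_mod (p\<^sup>2) \<union> ?M"
    moreover have "p * t < p\<^sup>2" if "t < p" for t
      using that p1 by (simp add: power2_eq_square)
    moreover have "\<exists>a<p\<^sup>2. x = int a" if "x \<in> units_mod (p\<^sup>2)"
      using units_mod_less[OF that q1] that by (intro exI[of _ "nat x"]) (auto simp: units_mod_def nat_less_iff simp del: of_nat_power)
    ultimately show "x \<in> int ` {..<p\<^sup>2}"
      by (auto simp flip: of_nat_mult)
  qed
  have disj: "units_mod (p\<^sup>2) \<inter> ?M = {}"
  proof -
    have "\<not> coprime (int p * int t) (int (p\<^sup>2))" for t
      using pp not_prime_unit[of "int p"] by auto
    thus ?thesis by (auto simp: units_mod_def)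
  qed
  have "of_nat (p\<^sup>2) * of_bool (int (p\<^sup>2) dvd m) = (\<Sum>t<p\<^sup>2. ?f (int t))"
    using sum_zeta_powi[OF less_trans[OF zero_less_one q1], of m] by (simp del: of_nat_power)
  also have "\<dots> = sum ?f (int ` {..<p\<^sup>2})"
    by (simp add: sum.reindex)
  also have "\<dots> = sum ?f (units_mod (p\<^sup>2)) + sum ?f ?M"
    unfolding split by (intro sum.union_disjoint disj) auto
  also have "sum ?f ?M = (\<Sum>t<p. zeta p powi (m * int t))"
  proof -
    have "inj_on (\<lambda>t. int p * int t) {..<p}" using p1 by (auto simp: inj_on_def)
    hence "sum ?f ?M = (\<Sum>t<p. zeta (p * p) powi (int p * (m * int t)))"
      by (simp add: sum.reindex power2_eq_square mult_ac)
    thus ?thesis using p1 by (simp add: zeta_mult_powi)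
  qed
  also have "\<dots> = of_nat p * of_bool (int p dvd m)"
    using sum_zeta_powi[of p m] p1 by simp
  finally show ?thesis by (simp add: algebra_simps)
qed

lemma sum_units_mod_power:
  fixes p n :: nat
  assumes p: "prime p" "odd p"
  shows "(\<Sum>v\<in>units_mod (p\<^sup>2). (zeta (p\<^sup>2) powi (2 * v) + zeta (p\<^sup>2) powi (- 2 * v)) ^ n) =
    of_nat p ^ 2 * of_nat (\<Sum>j\<le>n. of_bool (int (p\<^sup>2) dvd 2 * int j - int n) * (n choose j))
    - of_nat p * of_nat (\<Sum>j\<le>n. of_bool (int p dvd 2 * int j - int n) * (n choose j))"
proof -
  have c2: "coprime (int p) 2" "coprime (int (p\<^sup>2)) 2"
    using p(2) by simp_all
  have power_term: "(zeta (p\<^sup>2) powi (2 * v)) ^ j * (zeta (p\<^sup>2) powi (- 2 * v)) ^ (n - j) =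
      zeta (p\<^sup>2) powi (2 * (2 * int j - int n) * v)" if "j \<le> n" for j v
  proof -
    have "(zeta (p\<^sup>2) powi (2 * v)) ^ j * (zeta (p\<^sup>2) powi (- 2 * v)) ^ (n - j) =
      zeta (p\<^sup>2) powi (2 * v * int j + (- 2 * v) * int (n - j))"
      by (simp only: power_int_add[OF disjI1[OF zeta_nonzero]] power_int_mult power_int_of_nat)
    also have "2 * v * int j + (- 2 * v) * int (n - j) = 2 * (2 * int j - int n) * v"
      using that by (simp add: of_nat_diff algebra_simps)
    finally show ?thesis .
  qed
  have dvd: "int p dvd 2 * k \<longleftrightarrow> int p dvd k" "int (p\<^sup>2) dvd 2 * k \<longleftrightarrow> int (p\<^sup>2) dvd k" for k
    by (rule coprime_dvd_mult_right_iff[OF c2(1)], rule coprime_dvd_mult_right_iff[OF c2(2)])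
  have "(\<Sum>v\<in>units_mod (p\<^sup>2). (zeta (p\<^sup>2) powi (2 * v) + zeta (p\<^sup>2) powi (- 2 * v)) ^ n) =
     (\<Sum>v\<in>units_mod (p\<^sup>2). \<Sum>j\<le>n. of_nat (n choose j) * zeta (p\<^sup>2) powi (2 * (2 * int j - int n) * v))"
    unfolding binomial_ring by (intro sum.cong refl) (simp only: mult.assoc power_term atMost_iff)
  also have "\<dots> = (\<Sum>j\<le>n. of_nat (n choose j) * (\<Sum>v\<in>units_mod (p\<^sup>2). zeta (p\<^sup>2) powi (2 * (2 * int j - int n) * v)))"
    by (subst sum.swap) (simp add: sum_distrib_left)
  also have "\<dots> = (\<Sum>j\<le>n. of_nat (n choose j) * (of_nat p ^ 2 * of_bool (int (p\<^sup>2) dvd 2 * int j - int n) 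
      - of_nat p * of_bool (int p dvd 2 * int j - int n)))"
    by (simp only: sum_units_mod_prime_square_zeta[OF p(1)] dvd)
  also have "\<dots> = of_nat p ^ 2 * of_nat (\<Sum>j\<le>n. of_bool (int (p\<^sup>2) dvd 2 * int j - int n) * (n choose j))
    - of_nat p * of_nat (\<Sum>j\<le>n. of_bool (int p dvd 2 * int j - int n) * (n choose j))"
    unfolding of_nat_sum sum_distrib_left sum_subtractf[symmetric]
    by (intro sum.cong refl) (simp add: algebra_simps)
  finally show ?thesis .
qed

section \<open>Binomial sums over residue classes\<close>

lemma sum_binomial_Suc:
  fixes g :: "nat \<Rightarrow> nat"
  shows "(\<Sum>j\<le>Suc m. g j * (Suc m choose j)) = (\<Sum>i\<le>m. (g i + g (Suc i)) * (m choose i))"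
proof -
  have "(\<Sum>j\<le>Suc m. g j * (Suc m choose j)) = g 0 + (\<Sum>i\<le>m. g (Suc i) * (Suc m choose Suc i))"
    by (subst sum.atMost_Suc_shift) simp
  also have "\<dots> = (g 0 + (\<Sum>i\<le>m. g (Suc i) * (m choose Suc i))) + (\<Sum>i\<le>m. g (Suc i) * (m choose i))"
    by (simp add: algebra_simps sum.distrib)
  also have "g 0 + (\<Sum>i\<le>m. g (Suc i) * (m choose Suc i)) = (\<Sum>j\<le>Suc m. g j * (m choose j))"
    by (subst sum.atMost_Suc_shift) simp
  also have "\<dots> = (\<Sum>i\<le>m. g i * (m choose i))" by simp
  finally show ?thesis by (simp add: algebra_simps sum.distrib)
qed

text \<open>
  Two steps of Pascal's rule produce the classes $2i \equiv m + 2$, $m$ and $m - 2$ modulo $d$ with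
  multiplicities $1$, $2$ and $1$. The reflection $i \mapsto m - i$ exchanges the two outer classes, so
  everything occurs twice. Since $d$ does not divide $2$, the remaining two classes are disjoint and may be
  joined into one sum.
\<close>

lemma sum_binomial_centered_class:
  fixes d :: int
  assumes "\<not> d dvd 2"
  shows "(\<Sum>j\<le>m + 2. of_bool (d dvd 2 * int j - int (m + 2)) * (m + 2 choose j)) =
    2 * (\<Sum>i\<le>m. of_bool (d dvd 2 * int i - int m \<or> d dvd 2 * int i - int m + 2) * (m choose i))"
proof -
  let ?S = "\<lambda>c. \<Sum>i\<le>m. of_bool (d dvd 2 * int i - int m + c) * (m choose i)"
  let ?g = "\<lambda>j. of_bool (d dvd 2 * int j - int (m + 2)) :: nat"
  have "(\<Sum>j\<le>m + 2. ?g j * (m + 2 choose j)) =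
      (\<Sum>i\<le>m. (?g i + ?g (Suc i) + (?g (Suc i) + ?g (Suc (Suc i)))) * (m choose i))"
    by (simp only: add_2_eq_Suc' sum_binomial_Suc)
  also have "\<dots> = ?S (- 2) + ?S 0 + (?S 0 + ?S 2)"
  proof -
    have "?g i = of_bool (d dvd 2 * int i - int m + - 2)"
         "?g (Suc i) = of_bool (d dvd 2 * int i - int m + 0)"
         "?g (Suc (Suc i)) = of_bool (d dvd 2 * int i - int m + 2)" for i
      by (simp_all add: algebra_simps)
    thus ?thesis
      by (simp only: sum.distrib distrib_right)
  qed
  also have "?S (- 2) = ?S 2"
  proof -
    have "?S (- 2) = (\<Sum>i\<le>m. of_bool (d dvd 2 * int (m - i) - int m + - 2) * (m choose (m - i)))"
      by (rule sum.reindex_bij_witness[of _ "\<lambda>i. m - i" "\<lambda>i. m - i"]) auto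
    also have "\<dots> = ?S 2"
    proof (intro sum.cong refl)
      fix i assume "i \<in> {..m}"
      hence i: "i \<le> m" by simp
      have "2 * int (m - i) - int m + - 2 = - (2 * int i - int m + 2)"
        using i by (simp add: of_nat_diff)
      hence "d dvd 2 * int (m - i) - int m + - 2 \<longleftrightarrow> d dvd 2 * int i - int m + 2"
        by (simp only: dvd_minus_iff)
      thus "of_bool (d dvd 2 * int (m - i) - int m + - 2) * (m choose (m - i)) =
          of_bool (d dvd 2 * int i - int m + 2) * (m choose i)"
        using i by (simp only: binomial_symmetric[symmetric])
    qed
    finally show ?thesis .
  qed
  also have "?S 2 + ?S 0 + (?S 0 + ?S 2) = 2 * (?S 0 + ?S 2)" by simp
  also have "?S 0 + ?S 2 = (\<Sum>i\<le>m. of_bool (d dvd 2 * int i - int m \<or> d dvd 2 * int i - int m + 2) * (m choose i))"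
    unfolding sum.distrib[symmetric]
  proof (intro sum.cong refl)
    fix i
    have "\<not> (d dvd 2 * int i - int m \<and> d dvd 2 * int i - int m + 2)"
      using assms dvd_add_right_iff by blast
    thus "of_bool (d dvd 2 * int i - int m + 0) * (m choose i) + of_bool (d dvd 2 * int i - int m + 2) * (m choose i) =
      of_bool (d dvd 2 * int i - int m \<or> d dvd 2 * int i - int m + 2) * (m choose i)"
      by auto
  qed
  finally show ?thesis .
qed

lemma sum_int_range_choose:
  fixes m :: nat
  shows "(\<Sum>i | 0 \<le> i \<and> i \<le> int m \<and> Q i. m choose nat i) = (\<Sum>i\<le>m. of_bool (Q (int i)) * (m choose i))"
proof -
  have "{i. 0 \<le> i \<and> i \<le> int m \<and> Q i} = int ` {i. i \<le> m \<and> Q (int i)}"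
  proof (intro equalityI subsetI)
    fix i assume "i \<in> {i. 0 \<le> i \<and> i \<le> int m \<and> Q i}"
    hence "i = int (nat i)" "nat i \<in> {i. i \<le> m \<and> Q (int i)}" by auto
    thus "i \<in> int ` {i. i \<le> m \<and> Q (int i)}" by blast
  qed auto
  hence "(\<Sum>i | 0 \<le> i \<and> i \<le> int m \<and> Q i. m choose nat i) = (\<Sum>i | i \<le> m \<and> Q (int i). m choose i)"
    by (simp add: sum.reindex)
  also have "\<dots> = (\<Sum>i\<in>{i\<in>{..m}. Q (int i)}. m choose i)" by simp
  also have "\<dots> = (\<Sum>i\<le>m. if Q (int i) then m choose i else 0)"
    by (rule sum.inter_filter) simp
  also have "\<dots> = (\<Sum>i\<le>m. of_bool (Q (int i)) * (m choose i))"
    by (intro sum.cong refl) simp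
  finally show ?thesis .
qed

section \<open>Moments modulo the square of a prime\<close>

lemma kloosterman_moment_prime_square:
  fixes p n :: nat
  assumes p: "prime p" "odd p" and n: "n > 0"
  shows "2 * kloosterman_moment n (p\<^sup>2) = of_nat p ^ n * 
    (of_nat p ^ 2 * of_nat (\<Sum>j\<le>n. of_bool (int (p\<^sup>2) dvd 2 * int j - int n) * (n choose j))
    - of_nat p * of_nat (\<Sum>j\<le>n. of_bool (int p dvd 2 * int j - int n) * (n choose j)))"
proof -
  have "kloosterman (v\<^sup>2) 1 (p\<^sup>2) = of_nat p * (zeta (p\<^sup>2) powi (2 * v) + zeta (p\<^sup>2) powi (- 2 * v))"
    if "v \<in> units_mod (p\<^sup>2)" for v
    using that by (intro kloosterman_prime_square_at_square[OF p]) (simp add: units_mod_def)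
  hence "2 * kloosterman_moment n (p\<^sup>2) = (\<Sum>v\<in>units_mod (p\<^sup>2).
      of_nat p ^ n * (zeta (p\<^sup>2) powi (2 * v) + zeta (p\<^sup>2) powi (- 2 * v)) ^ n)"
    unfolding kloosterman_moment_prime_square_square_roots[OF assms]
    by (intro sum.cong refl) (simp only: power_mult_distrib)
  thus ?thesis
    by (simp only: sum_distrib_left[symmetric] sum_units_mod_power[OF p])
qed

theorem proposition5:
  fixes p n :: nat
  assumes "prime p" and "n > 0"
  shows
    "(odd n \<and> odd p \<and> p ^ 2 > n \<longrightarrow>
       kloosterman_moment n (p ^ 2) =
         - (of_nat p ^ (n + 1)) *
           of_nat (\<Sum>i | 0 \<le> i \<and> i \<le> int n - 2 \<and>
               ([2 * i = int n - 2] (mod int p) \<or> [2 * i = int n - 4] (mod int p)).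
             (n - 2) choose nat i))
     \<and>
     (even n \<and> real p > max 2 (sqrt (real n / 2)) \<longrightarrow>
       kloosterman_moment n (p ^ 2) =
         of_nat ((n - 1) choose (n div 2 - 1)) * ((of_nat p - 1) / of_nat p) * of_nat p ^ (n + 2)
         - of_nat p ^ (n + 1) *
           of_nat (\<Sum>i | 0 \<le> i \<and> i \<le> int n - 2 \<and>
               ([i = int n div 2 - 1] (mod int p) \<or> [i = int n div 2 - 2] (mod int p)) \<and>
               i \<noteq> int n div 2 - 1 \<and> i \<noteq> int n div 2 - 2.
             (n - 2) choose nat i))"
proof (intro conjI impI; elim conjE)
  assume n: "odd n" and p2: "odd p" and np: "p ^ 2 > n"
  let ?R = "\<Sum>i | 0 \<le> i \<and> i \<le> int n - 2 \<and>
      ([2 * i = int n - 2] (mod int p) \<or> [2 * i = int n - 4] (mod int p)). (n - 2) choose nat i"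
  have p: "prime p" "odd p" using assms p2 by auto
  have no_p2: "\<not> int (p\<^sup>2) dvd 2 * int j - int n" if "j \<le> n" for j
  proof
    assume d: "int (p\<^sup>2) dvd 2 * int j - int n"
    have "\<bar>2 * int j - int n\<bar> < int (p\<^sup>2)"
      using that np by linarith
    hence "2 * int j - int n = 0"
      using d dvd_imp_le_int[of "2 * int j - int n" "int (p\<^sup>2)"] by linarith
    thus False using n by presburger
  qed
  \<comment> \<open>Pascal's rule cannot be applied twice for $n = 1$. There both sums vanish: the right one is empty, and
    $2j - 1$ is $1$ or $-1$ in the left one.\<close>
  have class_sum: "(\<Sum>j\<le>n. of_bool (int p dvd 2 * int j - int n) * (n choose j)) = 2 * ?R"
  proof (cases "n = 1")
    case True
    have "\<not> int p dvd 1" using p prime_gt_1_nat[of p] by auto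
    moreover from this have "\<not> int p dvd - 1" by simp
    ultimately have "(\<Sum>j\<le>n. of_bool (int p dvd 2 * int j - int n) * (n choose j)) = 0"
      using True by simp
    moreover have "{i. 0 \<le> i \<and> i \<le> int n - 2 \<and>
      ([2 * i = int n - 2] (mod int p) \<or> [2 * i = int n - 4] (mod int p))} = {}"
      using True by auto
    ultimately show ?thesis by (simp only: sum.empty mult_0_right)
  next
    case False
    with \<open>n > 0\<close> n have "n \<ge> 2" by linarith
    then obtain m where m: "n = m + 2" by (metis add.commute le_Suc_ex)
    have eq: "int n - 2 = int m" "int n - 4 = int m - 2" "n - 2 = m" using m by auto
    show ?thesis
      unfolding m sum_binomial_centered_class[OF odd_prime_not_dvd_2[OF p]]
      unfolding m[symmetric] eq sum_int_range_choose
      by (simp add: cong_iff_dvd_diff algebra_simps)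
  qed
  have "2 * kloosterman_moment n (p\<^sup>2) = of_nat p ^ n * (- (of_nat p * of_nat (2 * ?R)))"
    unfolding kloosterman_moment_prime_square[OF p \<open>n > 0\<close>] class_sum
    by (simp add: no_p2 del: of_nat_power)
  also have "\<dots> = 2 * (- (of_nat p ^ (n + 1)) * of_nat ?R)"
    by (simp only: of_nat_mult) (simp add: algebra_simps)
  finally show "kloosterman_moment n (p\<^sup>2) = - (of_nat p ^ (n + 1)) * of_nat ?R"
    by (simp only: mult_cancel_left) simp
next
  assume n: "even n" and pmax: "real p > max 2 (sqrt (real n / 2))"
  let ?R = "\<Sum>i | 0 \<le> i \<and> i \<le> int n - 2 \<and>
               ([i = int n div 2 - 1] (mod int p) \<or> [i = int n div 2 - 2] (mod int p)) \<and>
               i \<noteq> int n div 2 - 1 \<and> i \<noteq> int n div 2 - 2.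
             (n - 2) choose nat i"
  have "p > 2" using pmax by simp
  hence p: "prime p" "odd p" using assms prime_odd_nat by auto
  obtain h where h: "n = 2 * h" using n by blast
  with \<open>n > 0\<close> have "h > 0" by simp
  then obtain k where k: "h = Suc k" by (cases h) auto
  define m where "m = 2 * k"
  have m: "n = m + 2" by (simp add: h k m_def)
  have hp: "h < p\<^sup>2"
  proof -
    have "sqrt (real h) < real p" using pmax h by simp
    hence "real h < (real p)\<^sup>2" using real_less_rsqrt not_le by (metis of_nat_0_le_iff real_le_rsqrt real_sqrt_le_iff)
    thus ?thesis by (metis of_nat_less_iff of_nat_power)
  qed
  have odd_dvd: "d dvd 2 * x \<longleftrightarrow> d dvd x" if "odd d" for d x :: int
    using that by (simp add: coprime_dvd_mult_right_iff)
  have "int (p\<^sup>2) dvd 2 * int j - int n \<longleftrightarrow> j = h" if "j \<le> n" for j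
  proof -
    have "2 * int j - int n = 2 * (int j - int h)" using h by simp
    moreover have "odd (int (p\<^sup>2))" using p by simp
    ultimately have "int (p\<^sup>2) dvd 2 * int j - int n \<longleftrightarrow> int (p\<^sup>2) dvd int j - int h"
      using odd_dvd by metis
    also have "\<dots> \<longleftrightarrow> j = h"
    proof
      assume d: "int (p\<^sup>2) dvd int j - int h"
      have "\<bar>int j - int h\<bar> < int (p\<^sup>2)"
        using that hp h by linarith
      hence "int j - int h = 0"
        using d dvd_imp_le_int[of "int j - int h" "int (p\<^sup>2)"] by linarith
      thus "j = h" by simp
    qed simp
    finally show ?thesis .
  qed
  hence "(\<Sum>j\<le>n. of_bool (int (p\<^sup>2) dvd 2 * int j - int n) * (n choose j)) = 
      (\<Sum>j\<le>n. if j = h then n choose j else 0)"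
    by (intro sum.cong refl) simp
  also have "\<dots> = n choose h" using h by simp
  also have "\<dots> = 2 * ((n - 1) choose k)"
    using binomial_symmetric[of "Suc k" "2 * k + 1"] by (simp add: h k)
  finally have square_sum: "(\<Sum>j\<le>n. of_bool (int (p\<^sup>2) dvd 2 * int j - int n) * (n choose j)) = 
     2 * ((n - 1) choose k)" .
  have class_sum: "(\<Sum>j\<le>n. of_bool (int p dvd 2 * int j - int n) * (n choose j)) = 
     2 * (((n - 1) choose k) + ?R)"
  proof -
    let ?P = "\<lambda>i. [i = int k] (mod int p) \<or> [i = int k - 1] (mod int p)"
    let ?c = "\<lambda>i. i = int k \<or> i = int k - 1"
    have eq: "int n - 2 = int m" "int n div 2 - 1 = int k" "int n div 2 - 2 = int k - 1" "n - 2 = m"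
      by (simp_all add: m m_def)
    have R: "?R = (\<Sum>i\<le>m. of_bool (?P (int i) \<and> int i \<noteq> int k \<and> int i \<noteq> int k - 1) * (m choose i))"
      unfolding eq by (rule sum_int_range_choose)
    have "(\<Sum>j\<le>n. of_bool (int p dvd 2 * int j - int n) * (n choose j)) = 
       2 * (\<Sum>i\<le>m. of_bool (int p dvd 2 * int i - int m \<or> int p dvd 2 * int i - int m + 2) * (m choose i))"
      unfolding m by (rule sum_binomial_centered_class[OF odd_prime_not_dvd_2[OF p]])
    also have "(\<Sum>i\<le>m. of_bool (int p dvd 2 * int i - int m \<or> int p dvd 2 * int i - int m + 2) * (m choose i)) =
       (\<Sum>i\<le>m. of_bool (?c (int i)) * (m choose i)
          + of_bool (?P (int i) \<and> int i \<noteq> int k \<and> int i \<noteq> int k - 1) * (m choose i))"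
    proof (intro sum.cong refl)
      fix i
      have "2 * int i - int m = 2 * (int i - int k)" "2 * int i - int m + 2 = 2 * (int i - (int k - 1))"
        by (simp_all add: m_def)
      moreover have podd: "odd (int p)" using p by simp
      ultimately have "int p dvd 2 * int i - int m \<or> int p dvd 2 * int i - int m + 2 \<longleftrightarrow> ?P (int i)"
        by (simp only: odd_dvd[OF podd] cong_iff_dvd_diff)
      moreover have "?c (int i) \<Longrightarrow> ?P (int i)" by auto
      ultimately show "of_bool (int p dvd 2 * int i - int m \<or> int p dvd 2 * int i - int m + 2) * (m choose i) =
        of_bool (?c (int i)) * (m choose i)
          + of_bool (?P (int i) \<and> int i \<noteq> int k \<and> int i \<noteq> int k - 1) * (m choose i)"
        by (cases "?c (int i)") auto
    qed
    also have "\<dots> = (\<Sum>i\<le>m. of_bool (?c (int i)) * (m choose i)) + ?R"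
      unfolding R by (rule sum.distrib)
    \<comment> \<open>The two central coefficients; for $k = 0$ the index $k - 1$ is out of range and only one is left.\<close>
    also have "(\<Sum>i\<le>m. of_bool (?c (int i)) * (m choose i)) = (n - 1) choose k"
    proof (cases k)
      case 0
      thus ?thesis by (simp add: m_def h k)
    next
      case (Suc l)
      have "(\<Sum>i\<le>m. of_bool (?c (int i)) * (m choose i)) = (\<Sum>i\<in>{l, k}. m choose i)"
        by (rule sum.mono_neutral_cong_right) (auto simp: Suc m_def)
      thus ?thesis by (simp add: Suc m m_def)
    qed
    finally show ?thesis .
  qed
  have "2 * kloosterman_moment n (p\<^sup>2) = of_nat p ^ n * (of_nat p ^ 2 * of_nat (2 * ((n - 1) choose k))
     - of_nat p * of_nat (2 * (((n - 1) choose k) + ?R)))"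
    unfolding kloosterman_moment_prime_square[OF p \<open>n > 0\<close>] class_sum square_sum ..
  also have "\<dots> = 2 * (of_nat ((n - 1) choose k) * ((of_nat p - 1) / of_nat p) * of_nat p ^ (n + 2)
      - of_nat p ^ (n + 1) * of_nat ?R)"
    using \<open>p > 2\<close> by (simp only: of_nat_mult of_nat_add) (simp add: field_simps power_add power2_eq_square)
  finally show "kloosterman_moment n (p\<^sup>2) =
     of_nat ((n - 1) choose (n div 2 - 1)) * ((of_nat p - 1) / of_nat p) * of_nat p ^ (n + 2)
         - of_nat p ^ (n + 1) * of_nat ?R"
    by (simp only: mult_cancel_left) (simp add: h k)
qed

end
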